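(* Every $(\text{bull},\text{diamond})$-free MNPD graph is triangle-free.
   Context: Graphs are finite and simple. A bull is a triangle with two disjoint pendant edges; a diamond is $K_4$ minus an edge. A graph is perfect if $\chi(H)=\omega(H)$ for all induced subgraphs $H$. $G$ is perfectly divisible if for every induced subgraph $H$ of $G$, $V(H)$ can be partitioned into $A,B$ with $H[A]$ perfect and $\omega(H[B])<\omega(H)$. $G$ is MNPD (minimally non-perfectly divisible) if $G$ is not perfectly divisible but every proper induced subgraph of $G$ is perfectly divisible. *)

theory Defs
  imports "Graph_Theory.Digraph_Component" "Graph_Theory.Digraph_Isomorphism"
begin

text \<open>
  Finite simple graphs are the \<^locale>\<open>graph\<close>s of the library: finite, loop-free, symmetric
  digraphs without parallel arcs. An edge between \<open>u\<close> and \<open>v\<close> is a pair of opposite arcs, and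
  adjacency is \<^const>\<open>dominates\<close>. All definitions below are meant for such graphs.
\<close>

subsection \<open>Clique number, chromatic number, perfect graphs\<close>

definition clique :: "('a,'b) pre_digraph \<Rightarrow> 'a set \<Rightarrow> bool" where
  "clique G C \<longleftrightarrow> C \<subseteq> verts G \<and> (\<forall>u\<in>C. \<forall>v\<in>C. u \<noteq> v \<longrightarrow> u \<rightarrow>\<^bsub>G\<^esub> v)"

definition clique_number :: "('a,'b) pre_digraph \<Rightarrow> nat" where
  "clique_number G = Max {card C | C. clique G C}"

definition proper_colouring :: "('a,'b) pre_digraph \<Rightarrow> nat \<Rightarrow> ('a \<Rightarrow> nat) \<Rightarrow> bool" where
  "proper_colouring G k c \<longleftrightarrow>
     (\<forall>v\<in>verts G. c v < k) \<and> (\<forall>u v. u \<rightarrow>\<^bsub>G\<^esub> v \<longrightarrow> c u \<noteq> c v)"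

definition chromatic_number :: "('a,'b) pre_digraph \<Rightarrow> nat" where
  "chromatic_number G = (LEAST k. \<exists>c. proper_colouring G k c)"

definition perfect :: "('a,'b) pre_digraph \<Rightarrow> bool" where
  "perfect G \<longleftrightarrow> (\<forall>H. induced_subgraph H G \<longrightarrow> chromatic_number H = clique_number H)"

subsection \<open>Perfect divisibility\<close>

text \<open>
  The library admits the null graph. It has to be excluded as a choice of \<open>H\<close> here, since its clique
  number 0 cannot be decreased. The parts \<open>A\<close> and \<open>B\<close> may be empty (if \<open>H\<close> has no edges,
  \<open>B\<close> must be).
\<close>
definition perfectly_divisible :: "('a,'b) pre_digraph \<Rightarrow> bool" where
  "perfectly_divisible G \<longleftrightarrow>
     (\<forall>H. induced_subgraph H G \<and> verts H \<noteq> {} \<longrightarrow>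
       (\<exists>A B. A \<union> B = verts H \<and> A \<inter> B = {} \<and>
          perfect (H \<restriction> A) \<and> clique_number (H \<restriction> B) < clique_number H))"

definition MNPD :: "('a,'b) pre_digraph \<Rightarrow> bool" where
  "MNPD G \<longleftrightarrow> \<not> perfectly_divisible G \<and>
     (\<forall>H. induced_subgraph H G \<and> verts H \<noteq> verts G \<longrightarrow> perfectly_divisible H)"

subsection \<open>Forbidden induced subgraphs\<close>

definition induced_free :: "('c,'d) pre_digraph \<Rightarrow> ('a,'b) pre_digraph \<Rightarrow> bool" where
  "induced_free F G \<longleftrightarrow> \<not> (\<exists>H. induced_subgraph H G \<and> digraph_iso F H)"

text \<open>The graph on \<open>{..<n}\<close> whose edges are the pairs in \<open>E\<close>, taken in both directions.\<close>
definition graph_of :: "nat \<Rightarrow> nat rel \<Rightarrow> (nat, nat \<times> nat) pre_digraph" where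
  "graph_of n E = with_proj \<lparr>pverts = {..<n}, parcs = E \<union> E\<inverse>\<rparr>"

definition triangle_graph :: "(nat, nat \<times> nat) pre_digraph" where
  "triangle_graph = graph_of 3 {(0,1), (0,2), (1,2)}"

definition diamond_graph :: "(nat, nat \<times> nat) pre_digraph" where
  "diamond_graph = graph_of 4 {(0,1), (0,2), (0,3), (1,2), (1,3)}"

text \<open>The triangle is \<open>0,1,2\<close>; the pendant edges are \<open>03\<close> and \<open>14\<close>.\<close>
definition bull_graph :: "(nat, nat \<times> nat) pre_digraph" where
  "bull_graph = graph_of 5 {(0,1), (0,2), (1,2), (0,3), (1,4)}"

end

theory Submission
  imports Defs
begin

text \<open>
  In an MNPD graph no vertex is simplicial, because a simplicial vertex can be added to the
  perfect part of a good partition of the remaining graph. Let \<open>K\<close> be a maximal clique with at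
  least three vertices. Diamond-freeness gives every vertex outside \<open>K\<close> at most one neighbour in
  \<open>K\<close>; bull-freeness makes outside neighbours of distinct vertices of \<open>K\<close> adjacent. As no vertex
  of \<open>K\<close> is simplicial, each has an outside neighbour, and a further use of
  diamond-freeness makes it unique. The outside neighbours form a clique of the same kind, so
  \<open>K\<close> and this clique together form a component \<open>K\<^sub>n \<box> K\<^sub>2\<close>. Moving one of its matching edges to
  the perfect part and the rest of it to the other part extends a good partition of the
  rest of the graph, which is impossible.
\<close>

subsection \<open>Induced subgraphs\<close>

lemma induced_subgraph_eq_restrict:
  assumes "induced_subgraph H G"
  shows "H = G \<restriction> verts H"
proof -
  have "arcs H = arcs (G \<restriction> verts H)" "tail G = tail H" "head G = head H"
    using assms by (simp_all add: induced_subgraph_def subgraph_def compatible_def)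
  then show ?thesis by (intro pre_digraph.equality) simp_all
qed

lemma dominates_restrict_iff [simp]:
  "u \<rightarrow>\<^bsub>G \<restriction> S\<^esub> v \<longleftrightarrow> u \<rightarrow>\<^bsub>G\<^esub> v \<and> u \<in> S \<and> v \<in> S"
  by (auto simp: arcs_ends_conv)

lemma restrict_restrict: "T \<subseteq> S \<Longrightarrow> (G \<restriction> S) \<restriction> T = G \<restriction> T"
  by (intro pre_digraph.equality) auto

text \<open>Restricting twice is restricting once, so quantifying over induced subgraphs becomes
  quantifying over vertex sets.\<close>

lemma induced_subgraph_restrict_iff:
  assumes "wf_digraph G" "S \<subseteq> verts G"
  shows "induced_subgraph H (G \<restriction> S) \<longleftrightarrow> (\<exists>T\<subseteq>S. H = G \<restriction> T)"
proof
  assume "induced_subgraph H (G \<restriction> S)"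
  moreover from this have "verts H \<subseteq> S" by (auto simp: induced_subgraph_def subgraph_def)
  ultimately show "\<exists>T\<subseteq>S. H = G \<restriction> T"
    using induced_subgraph_eq_restrict restrict_restrict by metis
next
  assume "\<exists>T\<subseteq>S. H = G \<restriction> T"
  then obtain T where T: "T \<subseteq> S" "H = G \<restriction> T" by blast
  have "wf_digraph (G \<restriction> S)" by (rule wf_digraph.wellformed_induce_subgraph[OF assms(1)])
  then have "induced_subgraph ((G \<restriction> S) \<restriction> T) (G \<restriction> S)"
    using T(1) by (intro wf_digraph.induced_induce) auto
  with T show "induced_subgraph H (G \<restriction> S)" by (simp add: restrict_restrict)
qed

lemma graph_of_simps [simp]:
  "verts (graph_of n E) = {..<n}"
  "arcs (graph_of n E) = E \<union> E\<inverse>"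
  "tail (graph_of n E) = fst"
  "head (graph_of n E) = snd"
  by (simp_all add: graph_of_def)

text \<open>Turns a vertex map that preserves and reflects adjacency into a
  \<open>digraph_iso\<close>, so that later only adjacencies matter. Arcs are abstract, hence an arc
  map must be built as well.\<close>

lemma (in wf_digraph) not_induced_free_graph_of:
  assumes E: "E \<subseteq> {..<n} \<times> {..<n}"
    and f: "inj_on f {..<n}" "f ` {..<n} \<subseteq> verts G"
    and nomulti: "nomulti_digraph G"
    and adj: "\<And>i j. i < n \<Longrightarrow> j < n \<Longrightarrow> f i \<rightarrow>\<^bsub>G\<^esub> f j \<longleftrightarrow> (i, j) \<in> E \<union> E\<inverse>"
  shows "\<not> induced_free (graph_of n E) G"
proof -
  define h where "h = (\<lambda>(i, j). SOME e. e \<in> arcs G \<and> tail G e = f i \<and> head G e = f j)"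
  have h: "h (i, j) \<in> arcs G" "tail G (h (i, j)) = f i" "head G (h (i, j)) = f j"
    if "(i, j) \<in> E \<union> E\<inverse>" for i j
  proof -
    have "f i \<rightarrow>\<^bsub>G\<^esub> f j" using that E adj by blast
    then have "\<exists>e. e \<in> arcs G \<and> tail G e = f i \<and> head G e = f j"
      by (auto simp: arcs_ends_conv)
    from someI_ex[OF this]
    show "h (i, j) \<in> arcs G" "tail G (h (i, j)) = f i" "head G (h (i, j)) = f j"
      by (auto simp: h_def)
  qed
  define m where "m = \<lparr>iso_verts = f, iso_arcs = h, iso_head = head G, iso_tail = tail G\<rparr>"
  have inj_h: "inj_on h (E \<union> E\<inverse>)"
  proof (rule inj_onI, clarify)
    fix i j i' j' assume a: "(i, j) \<in> E \<union> E\<inverse>" "(i', j') \<in> E \<union> E\<inverse>" "h (i, j) = h (i', j')"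
    then have "f i = f i'" "f j = f j'" using h by metis+
    moreover have "i < n" "j < n" "i' < n" "j' < n" using a(1,2) E by auto
    ultimately show "i = i' \<and> j = j'" using f(1) by (auto dest: inj_onD)
  qed
  have "wf_digraph (graph_of n E)"
    using E by unfold_locales auto
  then have "pre_digraph.digraph_isomorphism (graph_of n E) m"
    using f(1) inj_h h by (auto simp: pre_digraph.digraph_isomorphism_def m_def)
  moreover have "app_iso m (graph_of n E) = G \<restriction> (f ` {..<n})"
  proof -
    have "h ` (E \<union> E\<inverse>) = {e \<in> arcs G. tail G e \<in> f ` {..<n} \<and> head G e \<in> f ` {..<n}}"
    proof (intro equalityI subsetI)
      fix e assume "e \<in> h ` (E \<union> E\<inverse>)"
      then obtain i j where ij: "(i, j) \<in> E \<union> E\<inverse>" "e = h (i, j)" by auto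
      then have "i < n" "j < n" using E by auto
      with ij h show "e \<in> {e \<in> arcs G. tail G e \<in> f ` {..<n} \<and> head G e \<in> f ` {..<n}}"
        by auto
    next
      fix e assume "e \<in> {e \<in> arcs G. tail G e \<in> f ` {..<n} \<and> head G e \<in> f ` {..<n}}"
      then obtain i j where ij: "e \<in> arcs G" "tail G e = f i" "head G e = f j" "i < n" "j < n"
        by auto
      then have "f i \<rightarrow>\<^bsub>G\<^esub> f j" by (auto simp: arcs_ends_conv intro: rev_image_eqI)
      with ij adj have mem: "(i, j) \<in> E \<union> E\<inverse>" by blast
      \<comment> \<open>Without parallel arcs, the arc picked by \<open>SOME\<close> is the only one
        from \<open>f i\<close> to \<open>f j\<close>; hence \<open>h\<close> hits every arc of the
        induced subgraph.\<close>
      with ij h have "e = h (i, j)"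
        using nomulti_digraph.no_multi_arcs[OF nomulti] by (simp add: arc_to_ends_def)
      with mem show "e \<in> h ` (E \<union> E\<inverse>)" by blast
    qed
    then show ?thesis
      by (intro pre_digraph.equality) (simp_all add: m_def)
  qed
  ultimately have "digraph_iso (graph_of n E) (G \<restriction> (f ` {..<n}))"
    unfolding digraph_iso_def by metis
  moreover have "induced_subgraph (G \<restriction> (f ` {..<n})) G"
    using f(2) by (rule induced_induce)
  ultimately show ?thesis unfolding induced_free_def by blast
qed

subsection \<open>Cliques and colourings\<close>

context graph
begin

lemma adj_sym: "u \<rightarrow>\<^bsub>G\<^esub> v \<Longrightarrow> v \<rightarrow>\<^bsub>G\<^esub> u"
  using sym_arcs by (rule arcs_ends_symmetric)

lemma adj_irrefl [simp]: "\<not> u \<rightarrow>\<^bsub>G\<^esub> u"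
  using no_loops by (auto simp: arcs_ends_conv)

lemma finite_cliques: "finite {C. clique G C}"
  by (rule finite_subset[of _ "Pow (verts G)"]) (auto simp: clique_def)

lemma clique_restrict_iff: "S \<subseteq> verts G \<Longrightarrow> clique (G \<restriction> S) C \<longleftrightarrow> clique G C \<and> C \<subseteq> S"
  by (auto simp: clique_def)

lemma clique_number_eq: "clique_number G = Max (card ` {C. clique G C})"
  unfolding clique_number_def by (rule arg_cong[of _ _ Max]) auto

lemma card_le_clique_number: "clique G C \<Longrightarrow> card C \<le> clique_number G"
  unfolding clique_number_eq using finite_cliques by auto

lemma clique_number_less_iff: "clique_number G < k \<longleftrightarrow> (\<forall>C. clique G C \<longrightarrow> card C < k)"
proof -
  have "clique G {}" by (simp add: clique_def)
  then have "card ` {C. clique G C} \<noteq> {}" by blast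
  then show ?thesis unfolding clique_number_eq using finite_cliques by simp
qed

lemma clique_number_attained: obtains C where "clique G C" "card C = clique_number G"
  using clique_number_less_iff[of "clique_number G"] card_le_clique_number
  by (metis le_neq_implies_less less_irrefl)

lemma graph_restrict:
  assumes "S \<subseteq> verts G"
  shows "graph (G \<restriction> S)"
proof -
  interpret H: digraph "G \<restriction> S"
    by (rule digraphI_induced) (rule induced_induce[OF assms])
  show ?thesis
  proof (rule H.graphI)
    show "symmetric (G \<restriction> S)"
      unfolding symmetric_def by (rule symI) (auto intro: adj_sym)
  qed
qed

text \<open>Vertices of a maximum clique get distinct colours, so no colouring uses fewer colours
  than the clique number. This removes \<open>LEAST\<close> from later arguments on
  perfection.\<close>

lemma chromatic_eq_clique_number_iff:
  "chromatic_number G = clique_number G \<longleftrightarrow> (\<exists>c. proper_colouring G (clique_number G) c)"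
proof -
  have lower: "clique_number G \<le> k" if "proper_colouring G k c" for k c
  proof -
    obtain C where C: "clique G C" "card C = clique_number G" by (rule clique_number_attained)
    have "inj_on c C"
      using C(1) that unfolding inj_on_def clique_def proper_colouring_def by blast
    moreover have "c ` C \<subseteq> {..<k}"
      using C(1) that by (auto simp: clique_def proper_colouring_def)
    ultimately have "card C \<le> card {..<k}" by (intro card_inj_on_le) auto
    with C show ?thesis by simp
  qed
  \<comment> \<open>An injective numbering of the vertices is a proper colouring, so the
    \<open>LEAST\<close> is attained.\<close>
  obtain c :: "'a \<Rightarrow> nat" and n where c: "c ` verts G = {i. i < n}" "inj_on c (verts G)"
    using finite_imp_inj_to_nat_seg[OF finite_verts] by blast
  have "c u \<noteq> c v" if "u \<rightarrow>\<^bsub>G\<^esub> v" for u v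
  proof -
    have "u \<in> verts G" "v \<in> verts G" "u \<noteq> v" using that adj_in_verts by auto
    then show ?thesis using c(2) by (auto dest: inj_onD)
  qed
  with c(1) have "proper_colouring G n c" by (auto simp: proper_colouring_def)
  then have "\<exists>k c. proper_colouring G k c" by blast
  then have "\<exists>c. proper_colouring G (chromatic_number G) c"
    unfolding chromatic_number_def by (rule LeastI_ex)
  moreover have "chromatic_number G \<le> k" if "\<exists>c. proper_colouring G k c" for k
    unfolding chromatic_number_def by (rule Least_le) (rule that)
  ultimately show ?thesis using lower by (metis order_antisym)
qed

lemma perfect_restrict_iff:
  assumes "A \<subseteq> verts G"
  shows "perfect (G \<restriction> A) \<longleftrightarrow> (\<forall>S\<subseteq>A. \<exists>c. proper_colouring (G \<restriction> S) (clique_number (G \<restriction> S)) c)"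
proof -
  have "chromatic_number (G \<restriction> S) = clique_number (G \<restriction> S) \<longleftrightarrow>
      (\<exists>c. proper_colouring (G \<restriction> S) (clique_number (G \<restriction> S)) c)" if "S \<subseteq> A" for S
    by (rule graph.chromatic_eq_clique_number_iff, rule graph_restrict) (use that assms in auto)
  then show ?thesis
    unfolding perfect_def induced_subgraph_restrict_iff[OF wf_digraph assms] by metis
qed

text \<open>In any \<open>S\<close> containing \<open>v\<close>, the neighbours of \<open>v\<close>
  form with \<open>v\<close> a clique, so they occupy fewer colours than the clique number and leave
  one for \<open>v\<close>. Only neighbours in \<open>A\<close> have to form a clique.\<close>

lemma perfect_insert_simplicial:
  assumes "perfect (G \<restriction> A)" "A \<subseteq> verts G" "v \<in> verts G"
    and simplicial: "clique G {u \<in> A. v \<rightarrow>\<^bsub>G\<^esub> u}"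
  shows "perfect (G \<restriction> insert v A)"
proof -
  have sub: "insert v A \<subseteq> verts G" using assms by auto
  have "\<exists>c. proper_colouring (G \<restriction> S) (clique_number (G \<restriction> S)) c" if S: "S \<subseteq> insert v A" for S
  proof (cases "v \<in> S \<and> v \<notin> A")
    case False
    with S have "S \<subseteq> A" by auto
    with assms show ?thesis by (simp add: perfect_restrict_iff)
  next
    case True
    define T where "T = S - {v}"
    have T: "T \<subseteq> A" "S = insert v T" "v \<notin> T" using S True by (auto simp: T_def)
    have vS: "S \<subseteq> verts G" and vT: "T \<subseteq> verts G" using S sub T by auto
    interpret GS: graph "G \<restriction> S" by (rule graph_restrict[OF vS])
    interpret GT: graph "G \<restriction> T" by (rule graph_restrict[OF vT])
    let ?k = "clique_number (G \<restriction> S)"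
    obtain c where c: "proper_colouring (G \<restriction> T) (clique_number (G \<restriction> T)) c"
      using assms(1,2) T(1) by (auto simp: perfect_restrict_iff)
    obtain C where "clique (G \<restriction> T) C" "card C = clique_number (G \<restriction> T)"
      by (rule GT.clique_number_attained)
    then have le: "clique_number (G \<restriction> T) \<le> ?k"
      using T(2) GS.card_le_clique_number[of C] vS vT by (auto simp: clique_restrict_iff)
    define N where "N = {u \<in> T. v \<rightarrow>\<^bsub>G\<^esub> u}"
    have fin: "finite N" using vT by (auto simp: N_def intro: finite_subset[OF _ finite_verts])
    have "clique (G \<restriction> S) (insert v N)"
    proof -
      have "clique G N"
        using simplicial T(1) unfolding clique_def N_def by blast
      then show ?thesis using T(2) vS assms(3) by (auto simp: clique_def N_def intro: adj_sym)
    qed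
    from GS.card_le_clique_number[OF this] have "card N < ?k"
      using fin T(3) by (simp add: N_def)
    then have "card (c ` N) < card {..<?k}"
      using card_image_le[OF fin, of c] by simp
    then obtain i where i: "i < ?k" "i \<notin> c ` N"
      by (metis card_mono[OF finite_imageI[OF fin]] lessThan_iff not_less subsetI)
    have "proper_colouring (G \<restriction> S) ?k (c(v := i))"
      unfolding proper_colouring_def
    proof (intro conjI allI ballI impI)
      fix u assume "u \<in> verts (G \<restriction> S)"
      then show "(c(v := i)) u < ?k"
        using c i(1) le T(2) by (auto simp: proper_colouring_def)
    next
      fix u w assume "u \<rightarrow>\<^bsub>G \<restriction> S\<^esub> w"
      then have uw: "u \<rightarrow>\<^bsub>G\<^esub> w" "w \<rightarrow>\<^bsub>G\<^esub> u" "u \<in> S" "w \<in> S" "u \<noteq> w" by (auto intro: adj_sym)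
      show "(c(v := i)) u \<noteq> (c(v := i)) w"
      proof (cases "u = v \<or> w = v")
        case True
        then show ?thesis using uw i(2) T by (auto simp: N_def)
      next
        case False
        then show ?thesis using uw c T by (auto simp: proper_colouring_def)
      qed
    qed
    then show ?thesis by blast
  qed
  then show ?thesis by (simp add: perfect_restrict_iff[OF sub])
qed

subsection \<open>Minimally non-perfectly divisible graphs\<close>

text \<open>An \<open>H\<close> without a good partition is itself not perfectly divisible, so by
  minimality it is all of \<open>G\<close>. Hence no partition of \<open>G\<close> with perfect
  \<open>A\<close> lowers the clique number on \<open>B\<close>.\<close>

lemma MNPD_no_partition:
  assumes "MNPD G" "A \<union> B = verts G" "A \<inter> B = {}" "perfect (G \<restriction> A)"
  shows "\<exists>C\<subseteq>B. clique G C \<and> card C = clique_number G"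
proof -
  have "\<not> perfectly_divisible G" using assms(1) by (simp add: MNPD_def)
  then obtain H where H: "induced_subgraph H G" "verts H \<noteq> {}"
    and no: "\<not> (\<exists>A B. A \<union> B = verts H \<and> A \<inter> B = {} \<and>
          perfect (H \<restriction> A) \<and> clique_number (H \<restriction> B) < clique_number H)"
    unfolding perfectly_divisible_def by blast
  have "wf_digraph H" using H(1) by (auto simp: induced_subgraph_def subgraph_def)
  then have "induced_subgraph H H" by (rule wf_digraph.induced_subgraph_refl)
  with no H(2) have "\<not> perfectly_divisible H" unfolding perfectly_divisible_def by blast
  with H(1) assms(1) have "verts H = verts G" unfolding MNPD_def by blast
  then have "H = G"
    using induced_subgraph_eq_restrict[OF H(1)]
      induced_subgraph_eq_restrict[OF induced_subgraph_refl] by simp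
  with no assms have "\<not> clique_number (G \<restriction> B) < clique_number G" by blast
  moreover have B: "B \<subseteq> verts G" using assms(2) by blast
  ultimately obtain C where "clique (G \<restriction> B) C" "\<not> card C < clique_number G"
    using graph.clique_number_less_iff[OF graph_restrict[OF B]] by blast
  then have "clique G C" "C \<subseteq> B" "card C = clique_number G"
    using card_le_clique_number[of C] B by (simp_all add: clique_restrict_iff)
  then show ?thesis by blast
qed

text \<open>Cliques in \<open>B\<close> are compared with the clique number of \<open>G\<close>
  rather than of \<open>G \<restriction> S\<close>. In this form the claim also covers empty
  \<open>S\<close>, about which perfect divisibility says nothing.\<close>

lemma MNPD_partition:
  assumes "MNPD G" "S \<subset> verts G"
  obtains A B where "A \<union> B = S" "A \<inter> B = {}" "perfect (G \<restriction> A)"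
    "\<And>C. clique G C \<Longrightarrow> C \<subseteq> B \<Longrightarrow> card C < clique_number G"
proof (cases "S = {}")
  case True
  obtain v where v: "v \<in> verts G" using assms(2) by blast
  then have "clique G {v}" by (simp add: clique_def)
  from card_le_clique_number[OF this] have "0 < clique_number G" by simp
  moreover have "perfect (G \<restriction> {})"
    unfolding perfect_restrict_iff[OF empty_subsetI] by (auto simp: proper_colouring_def)
  ultimately show ?thesis using True by (intro that[of "{}" "{}"]) auto
next
  case False
  have S: "S \<subseteq> verts G" using assms(2) by blast
  interpret GS: graph "G \<restriction> S" by (rule graph_restrict[OF S])
  have "induced_subgraph (G \<restriction> S) G" by (rule induced_induce[OF S])
  then have "perfectly_divisible (G \<restriction> S)" using assms unfolding MNPD_def by auto
  then obtain A B where AB: "A \<union> B = S" "A \<inter> B = {}" "perfect ((G \<restriction> S) \<restriction> A)"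
    "clique_number ((G \<restriction> S) \<restriction> B) < clique_number (G \<restriction> S)"
    using False GS.induced_subgraph_refl unfolding perfectly_divisible_def
    by (metis induce_subgraph_verts)
  have sub: "A \<subseteq> S" "B \<subseteq> S" "B \<subseteq> verts G" using AB S by auto
  show ?thesis
  proof (rule that[OF AB(1,2)])
    show "perfect (G \<restriction> A)" using AB(3) sub by (simp add: restrict_restrict)
    fix C assume C: "clique G C" "C \<subseteq> B"
    then have "clique (G \<restriction> B) C" using sub by (simp add: clique_restrict_iff)
    then have "card C \<le> clique_number (G \<restriction> B)"
      by (rule graph.card_le_clique_number[OF graph_restrict[OF sub(3)]])
    also have "\<dots> < clique_number (G \<restriction> S)" using AB(4) sub by (simp add: restrict_restrict)
    also have "\<dots> \<le> clique_number G"
    proof -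
      obtain D where "clique (G \<restriction> S) D" "card D = clique_number (G \<restriction> S)"
        by (rule GS.clique_number_attained)
      then show ?thesis using card_le_clique_number[of D] S by (simp add: clique_restrict_iff)
    qed
    finally show "card C < clique_number G" .
  qed
qed

text \<open>Putting a simplicial \<open>v\<close> into \<open>A\<close> keeps \<open>A\<close>
  perfect and leaves \<open>B\<close> unchanged, which would give a good partition of
  \<open>G\<close>.\<close>

lemma MNPD_no_simplicial:
  assumes "MNPD G" "v \<in> verts G"
  shows "\<not> clique G {u. v \<rightarrow>\<^bsub>G\<^esub> u}"
proof
  assume simp: "clique G {u. v \<rightarrow>\<^bsub>G\<^esub> u}"
  obtain A B where AB: "A \<union> B = verts G - {v}" "A \<inter> B = {}" "perfect (G \<restriction> A)"
    "\<And>C. clique G C \<Longrightarrow> C \<subseteq> B \<Longrightarrow> card C < clique_number G"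
    using MNPD_partition[OF assms(1), of "verts G - {v}"] assms(2) by blast
  have "perfect (G \<restriction> insert v A)"
  proof (rule perfect_insert_simplicial[OF AB(3) _ assms(2)])
    show "A \<subseteq> verts G" using AB(1) by blast
    show "clique G {u \<in> A. v \<rightarrow>\<^bsub>G\<^esub> u}" using simp by (auto simp: clique_def)
  qed
  moreover have "insert v A \<union> B = verts G" "insert v A \<inter> B = {}" using AB assms(2) by auto
  ultimately show False using MNPD_no_partition[OF assms(1)] AB(4) by (metis less_irrefl)
qed

subsection \<open>Maximal cliques in graphs without bulls and diamonds\<close>

text \<open>Maximality is phrased vertex by vertex because the arguments below start from a
  non-neighbour in \<open>K\<close> of an outside vertex.\<close>

definition maximal_clique :: "'a set \<Rightarrow> bool" where
  "maximal_clique K \<longleftrightarrow> clique G K \<and> (\<forall>v \<in> verts G - K. \<exists>u\<in>K. \<not> v \<rightarrow>\<^bsub>G\<^esub> u)"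

lemma clique_extends_to_maximal:
  assumes "clique G C"
  obtains K where "maximal_clique K" "C \<subseteq> K"
proof -
  obtain K where K: "clique G K" "C \<subseteq> K" "\<And>D. clique G D \<Longrightarrow> K \<subseteq> D \<Longrightarrow> K = D"
    using finite_has_maximal2[OF finite_cliques, of C] assms by auto
  have "\<exists>u\<in>K. \<not> v \<rightarrow>\<^bsub>G\<^esub> u" if "v \<in> verts G - K" for v
  proof (rule ccontr)
    assume "\<not> ?thesis"
    then have "clique G (insert v K)"
      using K(1) that by (auto simp: clique_def intro: adj_sym)
    then have "K = insert v K" by (rule K(3)) blast
    with that show False by blast
  qed
  with K that show ?thesis unfolding maximal_clique_def by blast
qed

section \<open>Diamonds, bulls and triangles as adjacency conditions\<close>

lemma no_diamond:
  assumes "induced_free diamond_graph G"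
    and edges: "a \<rightarrow>\<^bsub>G\<^esub> b" "a \<rightarrow>\<^bsub>G\<^esub> c" "a \<rightarrow>\<^bsub>G\<^esub> d" "b \<rightarrow>\<^bsub>G\<^esub> c" "b \<rightarrow>\<^bsub>G\<^esub> d"
    and "c \<noteq> d"
  shows "c \<rightarrow>\<^bsub>G\<^esub> d"
proof (rule ccontr)
  assume non: "\<not> c \<rightarrow>\<^bsub>G\<^esub> d"
  have non': "\<not> d \<rightarrow>\<^bsub>G\<^esub> c" using non adj_sym by blast
  have neq: "a \<noteq> b" "a \<noteq> c" "a \<noteq> d" "b \<noteq> c" "b \<noteq> d" using assms by auto
  \<comment> \<open>The edge \<open>a b\<close> lies in both triangles of the diamond;
    \<open>c\<close> and \<open>d\<close> are its non-adjacent pair.\<close>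
  let ?f = "\<lambda>i. [a, b, c, d] ! i" and ?E = "{(0,1), (0,2), (0,3), (1,2), (1,3)} :: nat rel"
  have "\<not> induced_free (graph_of 4 ?E) G"
  proof (rule not_induced_free_graph_of[where f = ?f])
    show "nomulti_digraph G" by (rule nomulti_digraph)
    show "inj_on ?f {..<4}" using neq \<open>c \<noteq> d\<close>
      by (intro inj_on_nth) auto
    show "?f ` {..<4} \<subseteq> verts G" using assms adj_in_verts
      by (auto simp: eval_nat_numeral less_Suc_eq)
    have adj: "\<forall>i<4. \<forall>j<4. ?f i \<rightarrow>\<^bsub>G\<^esub> ?f j \<longleftrightarrow> (i, j) \<in> ?E \<union> ?E\<inverse>"
      using edges edges[THEN adj_sym] non non' assms by (simp add: eval_nat_numeral All_less_Suc)
    show "?f i \<rightarrow>\<^bsub>G\<^esub> ?f j \<longleftrightarrow> (i, j) \<in> ?E \<union> ?E\<inverse>" if "i < 4" "j < 4" for i j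
      by (rule adj[rule_format, OF that])
  qed auto
  with assms(1) show False by (simp add: diamond_graph_def)
qed

text \<open>Otherwise the triangle \<open>a b c\<close> with pendant edges \<open>a d\<close> and
  \<open>b e\<close> would be an induced bull.\<close>

lemma no_bull:
  assumes "induced_free bull_graph G"
    and edges: "a \<rightarrow>\<^bsub>G\<^esub> b" "a \<rightarrow>\<^bsub>G\<^esub> c" "b \<rightarrow>\<^bsub>G\<^esub> c" "a \<rightarrow>\<^bsub>G\<^esub> d" "b \<rightarrow>\<^bsub>G\<^esub> e"
    and "\<not> d \<rightarrow>\<^bsub>G\<^esub> b" "\<not> d \<rightarrow>\<^bsub>G\<^esub> c" "\<not> e \<rightarrow>\<^bsub>G\<^esub> a" "\<not> e \<rightarrow>\<^bsub>G\<^esub> c"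
  shows "d \<rightarrow>\<^bsub>G\<^esub> e"
proof (rule ccontr)
  assume non: "\<not> d \<rightarrow>\<^bsub>G\<^esub> e"
  have non': "\<not> e \<rightarrow>\<^bsub>G\<^esub> d" "\<not> b \<rightarrow>\<^bsub>G\<^esub> d" "\<not> c \<rightarrow>\<^bsub>G\<^esub> d" "\<not> a \<rightarrow>\<^bsub>G\<^esub> e" "\<not> c \<rightarrow>\<^bsub>G\<^esub> e"
    using non assms adj_sym by blast+
  \<comment> \<open>The adjacency pattern forces distinctness: for instance \<open>e\<close> is
    adjacent to \<open>b\<close> and \<open>d\<close> is not.\<close>
  have neq: "a \<noteq> b" "a \<noteq> c" "a \<noteq> d" "a \<noteq> e" "b \<noteq> c" "b \<noteq> d" "b \<noteq> e" "c \<noteq> d" "c \<noteq> e" "d \<noteq> e"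
    using assms adj_sym by auto
  let ?f = "\<lambda>i. [a, b, c, d, e] ! i" and ?E = "{(0,1), (0,2), (1,2), (0,3), (1,4)} :: nat rel"
  have "\<not> induced_free (graph_of 5 ?E) G"
  proof (rule not_induced_free_graph_of[where f = ?f])
    show "nomulti_digraph G" by (rule nomulti_digraph)
    show "inj_on ?f {..<5}" using neq
      by (intro inj_on_nth) auto
    show "?f ` {..<5} \<subseteq> verts G" using assms adj_in_verts
      by (auto simp: eval_nat_numeral less_Suc_eq)
    have adj: "\<forall>i<5. \<forall>j<5. ?f i \<rightarrow>\<^bsub>G\<^esub> ?f j \<longleftrightarrow> (i, j) \<in> ?E \<union> ?E\<inverse>"
      using edges edges[THEN adj_sym] non non' assms by (simp add: eval_nat_numeral All_less_Suc)
    show "?f i \<rightarrow>\<^bsub>G\<^esub> ?f j \<longleftrightarrow> (i, j) \<in> ?E \<union> ?E\<inverse>" if "i < 5" "j < 5" for i j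
      by (rule adj[rule_format, OF that])
  qed auto
  with assms(1) show False by (simp add: bull_graph_def)
qed

lemma triangle_of_not_induced_free:
  assumes "\<not> induced_free triangle_graph G"
  obtains C where "clique G C" "card C = 3"
proof -
  obtain H f where H: "induced_subgraph H G" "pre_digraph.digraph_isomorphism triangle_graph f"
      "H = app_iso f triangle_graph"
    using assms unfolding induced_free_def digraph_iso_def by blast
  have wf: "wf_digraph triangle_graph"
    using H(2) by (simp add: pre_digraph.digraph_isomorphism_def)
  let ?C = "iso_verts f ` {..<3}"
  have sub: "arcs_ends H \<subseteq> arcs_ends G" "verts H \<subseteq> verts G"
    using induced_subgraph_eq_restrict[OF H(1)] H(1)
    by (metis dominates_restrict_iff subrelI, auto)
  have ends: "arcs_ends triangle_graph = {(0,1), (0,2), (1,2)} \<union> {(0,1), (0,2), (1,2)}\<inverse>"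
    by (simp add: triangle_graph_def arcs_ends_conv)
  have "clique G ?C"
    unfolding clique_def
  proof (intro conjI ballI impI)
    show "?C \<subseteq> verts G" using sub(2) H(3) by (simp add: triangle_graph_def)
    fix x y assume "x \<in> ?C" "y \<in> ?C" "x \<noteq> y"
    then obtain i j where ij: "i < 3" "j < 3" "i \<noteq> j" "x = iso_verts f i" "y = iso_verts f j"
      by auto
    then have "(i, j) \<in> arcs_ends triangle_graph" unfolding ends by auto
    then have "(x, y) \<in> arcs_ends H"
      unfolding H(3) wf_digraph.arcs_ends_app_iso_eq[OF wf H(2)] using ij(4,5) by auto
    then show "x \<rightarrow>\<^bsub>G\<^esub> y" using sub by blast
  qed
  moreover have "card ?C = 3"
    using H(2) by (simp add: pre_digraph.digraph_isomorphism_def triangle_graph_def card_image)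
  ultimately show ?thesis using that by blast
qed

section \<open>Neighbours outside a maximal clique\<close>

lemma ex_other_members:
  assumes "3 \<le> card K"
  shows "\<exists>c\<in>K. c \<noteq> a \<and> c \<noteq> b"
proof (rule ccontr)
  assume "\<not> ?thesis"
  then have "K \<subseteq> {a, b}" by blast
  then have "card K \<le> card {a, b}" by (intro card_mono) auto
  with assms show False by (cases "a = b") auto
qed

text \<open>By maximality \<open>v\<close> misses some \<open>c\<close> in \<open>K\<close>; with
  two neighbours \<open>a\<close>, \<open>b\<close> in \<open>K\<close>, the vertices
  \<open>a, b, v, c\<close> would induce a diamond.\<close>

lemma outside_vertex_unique_neighbour:
  assumes "induced_free diamond_graph G" "maximal_clique K" "v \<notin> K"
    and "a \<in> K" "b \<in> K" "v \<rightarrow>\<^bsub>G\<^esub> a" "v \<rightarrow>\<^bsub>G\<^esub> b"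
  shows "a = b"
proof (rule ccontr)
  assume "a \<noteq> b"
  have K: "x \<rightarrow>\<^bsub>G\<^esub> y" if "x \<in> K" "y \<in> K" "x \<noteq> y" for x y
    using assms(2) that by (auto simp: maximal_clique_def clique_def)
  have "v \<in> verts G" using assms(6) adj_in_verts by auto
  then obtain c where c: "c \<in> K" "\<not> v \<rightarrow>\<^bsub>G\<^esub> c"
    using assms(2,3) unfolding maximal_clique_def by blast
  have "v \<rightarrow>\<^bsub>G\<^esub> c"
  proof (rule no_diamond[OF assms(1), of a b])
    show "a \<rightarrow>\<^bsub>G\<^esub> b" using K assms \<open>a \<noteq> b\<close> by blast
    show "a \<rightarrow>\<^bsub>G\<^esub> v" "b \<rightarrow>\<^bsub>G\<^esub> v" using assms adj_sym by blast+
    show "a \<rightarrow>\<^bsub>G\<^esub> c" "b \<rightarrow>\<^bsub>G\<^esub> c" using K assms c by blast+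
    show "v \<noteq> c" using c assms(3) by blast
  qed
  with c show False by blast
qed

text \<open>Take a third vertex \<open>c\<close> of \<open>K\<close>. Each of \<open>d\<close>,
  \<open>e\<close> has just one neighbour in \<open>K\<close>, so if \<open>d\<close> and
  \<open>e\<close> were not adjacent, \<open>a b c\<close> with pendants \<open>d\<close>,
  \<open>e\<close> would be a bull.\<close>

lemma outside_neighbours_adjacent:
  assumes "induced_free bull_graph G" "induced_free diamond_graph G" "maximal_clique K" "3 \<le> card K"
    and "a \<in> K" "b \<in> K" "a \<noteq> b" "d \<notin> K" "e \<notin> K" "a \<rightarrow>\<^bsub>G\<^esub> d" "b \<rightarrow>\<^bsub>G\<^esub> e"
  shows "d \<rightarrow>\<^bsub>G\<^esub> e"
proof -
  obtain c where c: "c \<in> K" "c \<noteq> a" "c \<noteq> b" using ex_other_members[OF assms(4)] by blast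
  have K: "x \<rightarrow>\<^bsub>G\<^esub> y" if "x \<in> K" "y \<in> K" "x \<noteq> y" for x y
    using assms(3) that by (auto simp: maximal_clique_def clique_def)
  note uniq = outside_vertex_unique_neighbour[OF assms(2,3)]
  have da: "d \<rightarrow>\<^bsub>G\<^esub> a" and eb: "e \<rightarrow>\<^bsub>G\<^esub> b" using assms adj_sym by blast+
  show ?thesis
  proof (rule no_bull[OF assms(1), of a b c])
    show "a \<rightarrow>\<^bsub>G\<^esub> b" "a \<rightarrow>\<^bsub>G\<^esub> c" "b \<rightarrow>\<^bsub>G\<^esub> c" using K assms c by blast+
    show "\<not> d \<rightarrow>\<^bsub>G\<^esub> b" "\<not> d \<rightarrow>\<^bsub>G\<^esub> c" "\<not> e \<rightarrow>\<^bsub>G\<^esub> a" "\<not> e \<rightarrow>\<^bsub>G\<^esub> c"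
      using uniq[of d a b] uniq[of d a c] uniq[of e b a] uniq[of e b c] da eb assms(5-9) c by blast+
  qed fact+
qed

lemma ex1_outside_neighbour:
  assumes "induced_free bull_graph G" "induced_free diamond_graph G" "MNPD G"
    and "maximal_clique K" "3 \<le> card K" "a \<in> K"
  shows "\<exists>!d. a \<rightarrow>\<^bsub>G\<^esub> d \<and> d \<notin> K"
proof -
  have K: "clique G K" using assms(4) by (simp add: maximal_clique_def)
  have ex: "\<exists>d. x \<rightarrow>\<^bsub>G\<^esub> d \<and> d \<notin> K" if "x \<in> K" for x
  proof (rule ccontr)
    assume "\<not> ?thesis"
    then have "{u. x \<rightarrow>\<^bsub>G\<^esub> u} \<subseteq> K" by blast
    then have "clique G {u. x \<rightarrow>\<^bsub>G\<^esub> u}" using K unfolding clique_def by blast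
    moreover have "x \<in> verts G" using that K by (auto simp: clique_def)
    ultimately show False using MNPD_no_simplicial assms(3) by blast
  qed
  note complete = outside_neighbours_adjacent[OF assms(1,2,4,5)]
  note uniq = outside_vertex_unique_neighbour[OF assms(2,4)]
  have "d = d'" if d: "a \<rightarrow>\<^bsub>G\<^esub> d" "d \<notin> K" and d': "a \<rightarrow>\<^bsub>G\<^esub> d'" "d' \<notin> K" for d d'
  proof (rule ccontr)
    assume neq: "d \<noteq> d'"
    obtain b where b: "b \<in> K" "b \<noteq> a" using ex_other_members[OF assms(5)] by blast
    obtain c where c: "c \<in> K" "c \<noteq> a" "c \<noteq> b" using ex_other_members[OF assms(5)] by blast
    obtain e where e: "b \<rightarrow>\<^bsub>G\<^esub> e" "e \<notin> K" using ex b by blast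
    obtain f where f: "c \<rightarrow>\<^bsub>G\<^esub> f" "f \<notin> K" using ex c by blast
    have de: "d \<rightarrow>\<^bsub>G\<^esub> e" "d' \<rightarrow>\<^bsub>G\<^esub> e" "e \<rightarrow>\<^bsub>G\<^esub> d" "e \<rightarrow>\<^bsub>G\<^esub> d'" "f \<rightarrow>\<^bsub>G\<^esub> d" "f \<rightarrow>\<^bsub>G\<^esub> d'" "e \<rightarrow>\<^bsub>G\<^esub> f"
      using complete assms(6) b c d d' e f by metis+
    \<comment> \<open>Outside neighbours of distinct vertices of \<open>K\<close> are adjacent, so
      \<open>d\<close> and \<open>d'\<close> both form triangles with the edge
      \<open>e f\<close>.\<close>
    then have dd': "d \<rightarrow>\<^bsub>G\<^esub> d'" using no_diamond[OF assms(2), of e f d d'] neq by blast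
    have "a \<rightarrow>\<^bsub>G\<^esub> e"
      \<comment> \<open>Now \<open>a\<close> and \<open>e\<close> both form triangles with
        \<open>d d'\<close>; but \<open>e\<close> already has the neighbour \<open>b\<close> in
        \<open>K\<close>.\<close>
      using no_diamond[OF assms(2) dd', of a e] d d' de e assms(6) by (metis adj_sym)
    then show False using uniq[of e a b] e b assms(6) by (metis adj_sym)
  qed
  with ex[OF assms(6)] show ?thesis by blast
qed

text \<open>The map \<open>g\<close> matches \<open>K\<close> with a second maximal clique
  \<open>L\<close>, and \<open>K \<union> L\<close> has no edges to the rest. Splitting it between
  the two sides of a partition of the rest contradicts \<open>MNPD_no_partition\<close>.\<close>

lemma MNPD_clique_card_less_3:
  assumes bull: "induced_free bull_graph G" and diamond: "induced_free diamond_graph G"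
    and mnpd: "MNPD G" and K: "maximal_clique K"
  shows "card K < 3"
proof (rule ccontr)
  assume "\<not> ?thesis"
  then have card: "3 \<le> card K" by simp
  have adjK: "x \<rightarrow>\<^bsub>G\<^esub> y" if "x \<in> K" "y \<in> K" "x \<noteq> y" for x y
    using K that by (auto simp: maximal_clique_def clique_def)
  define g where "g a = (THE d. a \<rightarrow>\<^bsub>G\<^esub> d \<and> d \<notin> K)" for a
  have g: "a \<rightarrow>\<^bsub>G\<^esub> g a" "g a \<notin> K" if "a \<in> K" for a
    using theI'[OF ex1_outside_neighbour[OF bull diamond mnpd K card that]]
    by (simp_all add: g_def)
  have g_eq: "d = g a" if "a \<in> K" "a \<rightarrow>\<^bsub>G\<^esub> d" "d \<notin> K" for a d
    using ex1_outside_neighbour[OF bull diamond mnpd K card that(1)] that g[OF that(1)] by blast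
  have g_sym: "g a \<rightarrow>\<^bsub>G\<^esub> a" if "a \<in> K" for a using g[OF that] adj_sym by blast
  have g_inj: "a = b" if "a \<in> K" "b \<in> K" "g a = g b" for a b
    using outside_vertex_unique_neighbour[OF diamond K, of "g a" a b] g_sym[OF that(1)]
      g_sym[OF that(2)] g that by auto
  have "clique G (g ` K)"
    unfolding clique_def
  proof (intro conjI ballI impI)
    show "g ` K \<subseteq> verts G" using g(1) adj_in_verts by blast
    fix x y assume "x \<in> g ` K" "y \<in> g ` K" "x \<noteq> y"
    then show "x \<rightarrow>\<^bsub>G\<^esub> y"
      using outside_neighbours_adjacent[OF bull diamond K card] g by blast
  qed
  then obtain L where L: "maximal_clique L" "g ` K \<subseteq> L" by (rule clique_extends_to_maximal)
  have adjL: "x \<rightarrow>\<^bsub>G\<^esub> y" if "x \<in> L" "y \<in> L" "x \<noteq> y" for x y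
    using L that by (auto simp: maximal_clique_def clique_def)
  have "finite L"
    using L(1) by (auto simp: maximal_clique_def clique_def intro: finite_subset[OF _ finite_verts])
  \<comment> \<open>From here on \<open>L\<close> can take the role of \<open>K\<close> in the
    preceding lemmas.\<close>
  then have cardL: "3 \<le> card L"
    using card card_mono[OF _ L(2)] card_image[of g K] g_inj by (auto simp: inj_on_def)
  \<comment> \<open>Such an \<open>a\<close> would be adjacent to \<open>g b\<close> for another
    \<open>b\<close> in \<open>K\<close>, forcing \<open>g b = g a\<close>.\<close>
  have disj: False if "a \<in> K" "a \<in> L" for a
  proof -
    obtain b where "b \<in> K" "b \<noteq> a" using ex_other_members[OF card] by blast
    then show False
      using adjL[of a "g b"] that g_eq[of a "g b"] g[of b] g_inj[of a b] L(2) by (metis image_subset_iff)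
  qed
  have L_eq: "L = g ` K"
  proof (rule equalityI[OF subsetI L(2)])
    fix x assume x: "x \<in> L"
    show "x \<in> g ` K"
    proof (rule ccontr)
      assume notin: "x \<notin> g ` K"
      obtain y where y: "x \<rightarrow>\<^bsub>G\<^esub> y" "y \<notin> L"
        using ex1_outside_neighbour[OF bull diamond mnpd L(1) cardL x] by blast
      have yK: "y \<notin> K" using g_eq[of y x] y disj x notin adj_sym by blast
      \<comment> \<open>With respect to \<open>L\<close>, \<open>y\<close> and \<open>a\<close> are
        outside neighbours of the distinct vertices \<open>x\<close> and \<open>g a\<close>, hence
        adjacent. So \<open>y\<close> would be \<open>g a\<close>, which lies in
        \<open>L\<close>.\<close>
      have y_eq: "y = g a" if "a \<in> K" for a
      proof -
        have "y \<rightarrow>\<^bsub>G\<^esub> a"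
          by (rule outside_neighbours_adjacent[OF bull diamond L(1) cardL, of x "g a"])
             (use that x y notin L(2) disj g_sym in auto)
        then show ?thesis using that yK g_eq adj_sym by blast
      qed
      obtain a where "a \<in> K" using ex_other_members[OF card] by blast
      then show False using y_eq y(2) L(2) by auto
    qed
  qed
  have closed: "w \<in> K \<union> L" if u: "u \<in> K \<union> L" and uw: "u \<rightarrow>\<^bsub>G\<^esub> w" for u w
  proof (cases "u \<in> K")
    case True
    then show ?thesis using g_eq[of u w] uw L_eq by blast
  next
    case False
    then obtain a where a: "a \<in> K" "u = g a" "u \<in> L" using u L_eq by blast
    then have "a \<notin> L" using disj by blast
    then have "w = a" if "w \<notin> L"
      using ex1_outside_neighbour[OF bull diamond mnpd L(1) cardL a(3)] a g_sym
        uw that by blast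
    then show ?thesis using a by blast
  qed
  have sub: "K \<union> L \<subseteq> verts G" using K L(1) by (auto simp: maximal_clique_def clique_def)
  obtain a where a: "a \<in> K" using ex_other_members[OF card] by blast
  have ga: "g a \<in> L" using a L(2) by blast
  have "verts G - (K \<union> L) \<subset> verts G" using a sub by blast
  then obtain A B where AB: "A \<union> B = verts G - (K \<union> L)" "A \<inter> B = {}" "perfect (G \<restriction> A)"
    "\<And>C. clique G C \<Longrightarrow> C \<subseteq> B \<Longrightarrow> card C < clique_number G"
    by (rule MNPD_partition[OF mnpd]) blast
  have A: "A \<subseteq> verts G" "A \<inter> (K \<union> L) = {}" using AB(1) by blast+
  \<comment> \<open>First \<open>a\<close> is added with no neighbours in \<open>A\<close>, then
    \<open>g a\<close> with at most the neighbour \<open>a\<close>; both times the neighbourhood is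
    a clique.\<close>
  have "{u \<in> A. a \<rightarrow>\<^bsub>G\<^esub> u} = {}" using closed[of a] a A by blast
  then have "clique G {u \<in> A. a \<rightarrow>\<^bsub>G\<^esub> u}" unfolding clique_def by blast
  then have perf1: "perfect (G \<restriction> insert a A)"
    using perfect_insert_simplicial[OF AB(3) A(1)] a sub by blast
  have "{u \<in> insert a A. g a \<rightarrow>\<^bsub>G\<^esub> u} \<subseteq> {a}" using closed[of "g a"] ga A by blast
  then have "clique G {u \<in> insert a A. g a \<rightarrow>\<^bsub>G\<^esub> u}"
    using a sub unfolding clique_def by blast
  then have perf2: "perfect (G \<restriction> insert (g a) (insert a A))"
    using perfect_insert_simplicial[OF perf1] a ga A sub by blast
  let ?A = "insert (g a) (insert a A)" and ?B = "B \<union> (K \<union> L - {a, g a})"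
  have parts: "?A \<union> ?B = verts G" "?A \<inter> ?B = {}" using AB(1,2) a ga sub by auto
  obtain C where C: "C \<subseteq> ?B" "clique G C" "card C = clique_number G"
    using MNPD_no_partition[OF mnpd parts perf2] by blast
  have finC: "finite C" using C(2) by (auto simp: clique_def intro: finite_subset[OF _ finite_verts])
  have adjC: "x \<rightarrow>\<^bsub>G\<^esub> y" if "x \<in> C" "y \<in> C" "x \<noteq> y" for x y
    using C(2) that by (auto simp: clique_def)
  have "\<not> C \<subseteq> B" using AB(4) C by (metis less_irrefl)
  then obtain x where x: "x \<in> C" "x \<in> K \<union> L" using C(1) by blast
  \<comment> \<open>A clique meeting \<open>K \<union> L\<close> cannot leave it, by
    \<open>closed\<close>.\<close>
  have CKL: "C \<subseteq> K \<union> L - {a, g a}"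
  proof
    fix y assume y: "y \<in> C"
    then have "y \<in> K \<union> L" using closed[OF x(2)] adjC[OF x(1) y] x by (cases "x = y") auto
    with y C(1) a ga A(2) AB(1) show "y \<in> K \<union> L - {a, g a}" by blast
  qed
  \<comment> \<open>\<open>C\<close> is a maximum clique, so nothing can be added to it. Inside
    \<open>K\<close> the removed vertex \<open>a\<close> could be, inside \<open>L\<close> the
    vertex \<open>g a\<close>.\<close>
  have extend: False if "z \<in> verts G" "z \<notin> C" "\<And>y. y \<in> C \<Longrightarrow> z \<rightarrow>\<^bsub>G\<^esub> y" for z
  proof -
    have "clique G (insert z C)" using C(2) that by (auto simp: clique_def intro: adj_sym)
    from card_le_clique_number[OF this] show False using finC that(2) C(3) by simp
  qed
  consider "C \<subseteq> K" | "C \<subseteq> L" | c d where "c \<in> C" "c \<in> K" "d \<in> C" "d \<in> L"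
    using CKL by blast
  then show False
  proof cases
    case 1
    then show False using extend[of a] CKL adjK a sub by blast
  next
    case 2
    then show False using extend[of "g a"] CKL adjL ga sub by blast
  next
    case 3
    \<comment> \<open>Edges between \<open>K\<close> and \<open>L\<close> are matching edges, so a
      clique meeting both sides has at most two vertices, fewer than \<open>K\<close>.\<close>
    have "C \<subseteq> {c, d}"
    proof
      fix y assume y: "y \<in> C"
      show "y \<in> {c, d}"
      proof (cases "y \<in> K")
        case True
        then have "y \<rightarrow>\<^bsub>G\<^esub> d" "c \<rightarrow>\<^bsub>G\<^esub> d" using 3 y adjC disj by blast+
        moreover have "d \<notin> K" using 3 disj by blast
        ultimately have "y = c" using g_eq[OF True] g_eq[OF 3(2)] g_inj[OF True 3(2)] by simp
        then show ?thesis by simp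
      next
        case False
        then have "c \<rightarrow>\<^bsub>G\<^esub> y" "c \<rightarrow>\<^bsub>G\<^esub> d" using 3 y adjC disj by blast+
        moreover have "d \<notin> K" using 3 disj by blast
        ultimately have "y = d" using g_eq[OF 3(2)] False by metis
        then show ?thesis by simp
      qed
    qed
    then have "card C \<le> card {c, d}" by (intro card_mono) auto
    also have "\<dots> \<le> 2" by (cases "c = d") auto
    finally have "clique_number G < card K" using C(3) card by simp
    then show False using card_le_clique_number[of K] K by (simp add: maximal_clique_def)
  qed
qed

end

text \<open>A triangle would extend to a maximal clique with at least three vertices, against
  \<open>MNPD_clique_card_less_3\<close>.\<close>

theorem theorem7:
  fixes G :: "('a,'b) pre_digraph"
  assumes "graph G"
    and "induced_free bull_graph G"
    and "induced_free diamond_graph G"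
    and "MNPD G"
  shows "induced_free triangle_graph G"
proof (rule ccontr)
  assume no: "\<not> induced_free triangle_graph G"
  interpret graph G by (rule assms(1))
  obtain C where C: "clique G C" "card C = 3" using no by (rule triangle_of_not_induced_free)
  obtain K where K: "maximal_clique K" "C \<subseteq> K" using C(1) by (rule clique_extends_to_maximal)
  have "finite K"
    using K(1) by (auto simp: maximal_clique_def clique_def intro: finite_subset[OF _ finite_verts])
  then have "3 \<le> card K" using C(2) card_mono[OF _ K(2)] by simp
  with MNPD_clique_card_less_3[OF assms(2-4) K(1)] show False by simp
qed

end
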